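(* Let $\mathbf{x}$ and $\mathbf{y}$ be jointly distributed random vectors such that $\begin{pmatrix}\mathbf{x}\\ \mathbf{y}\end{pmatrix}$ has mean $\begin{pmatrix}\boldsymbol{\mu}_{\mathbf x}\\ \boldsymbol{\mu}_{\mathbf y}\end{pmatrix}$ and covariance matrix $\begin{pmatrix}\Sigma_{\mathbf{xx}}&\Sigma_{\mathbf{xy}}\\ \Sigma_{\mathbf{yx}}&\Sigma_{\mathbf{yy}}\end{pmatrix}$, with $\Sigma_{\mathbf{xx}}$ invertible. The estimator $\widehat{\mathbf{y}}_{A,\mathbf{b}}(\mathbf{x})=A\mathbf{x}+\mathbf{b}$ (with $A$ a matrix and $\mathbf{b}$ a vector of the appropriate sizes) for estimating the value of $\mathbf{y}$ for a given value of $\mathbf{x}$ is an unbiased estimator with minimal $MSE$ if $$\mathbf{b}=\boldsymbol{\mu}_{\mathbf y}-A\boldsymbol{\mu}_{\mathbf x},\qquad A=\Sigma_{\mathbf{yx}}\Sigma_{\mathbf{xx}}^{-1}.$$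
   Context: The matrices are $\Sigma_{\mathbf{xx}}=E[(\mathbf{x}-\boldsymbol{\mu}_{\mathbf x})(\mathbf{x}-\boldsymbol{\mu}_{\mathbf x})^{T}]$, $\Sigma_{\mathbf{yy}}=E[(\mathbf{y}-\boldsymbol{\mu}_{\mathbf y})(\mathbf{y}-\boldsymbol{\mu}_{\mathbf y})^{T}]$, $\Sigma_{\mathbf{yx}}=E[(\mathbf{y}-\boldsymbol{\mu}_{\mathbf y})(\mathbf{x}-\boldsymbol{\mu}_{\mathbf x})^{T}]$ and $\Sigma_{\mathbf{xy}}=\Sigma_{\mathbf{yx}}^{T}$. The estimator $\widehat{\mathbf{y}}=\widehat{\mathbf{y}}_{A,\mathbf{b}}(\mathbf{x})$ is unbiased if $E[\widehat{\mathbf{y}}]=E[\mathbf{y}]$. The mean square error of an unbiased estimator $\widehat{\mathbf{y}}$ with mean $\boldsymbol{\mu}_{\widehat{\mathbf{y}}}=E[\widehat{\mathbf{y}}]$ is defined as $MSE(\widehat{\mathbf{y}})=E[(\widehat{\mathbf{y}}-\boldsymbol{\mu}_{\widehat{\mathbf{y}}})^{T}(\widehat{\mathbf{y}}-\boldsymbol{\mu}_{\widehat{\mathbf{y}}})]$, that is, the sum of the variances of the components of $\widehat{\mathbf{y}}$ (the trace of its covariance matrix). Minimality is over the choice of $A$ and $\mathbf{b}$ for which the estimator is unbiased.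
   Formalization: The MSE is taken as E[(ŷ−y)^T(ŷ−y)], the error relative to the random y, not as the sum of variances of ŷ; with the latter the claim fails (x=y scalar of variance 1: A=1 gives 1, but the unbiased A=0, b=μ_y gives 0). *)

theory Defs
  imports "HOL-Probability.Probability"
begin

definition stack :: "'a^'n \<Rightarrow> 'a^'m \<Rightarrow> 'a^('n::finite + 'm::finite)" where
  "stack u v = (\<chi> k. case k of Inl i \<Rightarrow> u $ i | Inr j \<Rightarrow> v $ j)"

definition block_matrix ::
  "'a^'n^'n \<Rightarrow> 'a^'m^'n \<Rightarrow> 'a^'n^'m \<Rightarrow> 'a^'m^'m \<Rightarrow> 'a^('n::finite + 'm::finite)^('n + 'm)" where
  "block_matrix P Q R S =
     (\<chi> k. case k of Inl i \<Rightarrow> stack (P $ i) (Q $ i) | Inr j \<Rightarrow> stack (R $ j) (S $ j))"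

text \<open>The product \<open>u v\<^sup>T\<close>.\<close>

definition outer_product :: "real^'m \<Rightarrow> real^'n \<Rightarrow> real^'n^'m" where
  "outer_product u v = (columnvector u :: real^1^'m) ** (rowvector v :: real^'n^1)"

definition cross_covariance :: "'s measure \<Rightarrow> ('s \<Rightarrow> real^'m) \<Rightarrow> ('s \<Rightarrow> real^'n) \<Rightarrow> real^'n^'m" where
  "cross_covariance M u v =
     (\<integral>\<omega>. outer_product (u \<omega> - integral\<^sup>L M u) (v \<omega> - integral\<^sup>L M v) \<partial>M)"

text \<open>
  Having a mean and having a covariance matrix include the existence (integrability) of the
  expectations concerned, which the total function \<^const>\<open>lebesgue_integral\<close> does not record.
\<close>

definition has_mean :: "'s measure \<Rightarrow> ('s \<Rightarrow> real^'n) \<Rightarrow> real^'n \<Rightarrow> bool" where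
  "has_mean M z \<mu> \<longleftrightarrow> has_bochner_integral M z \<mu>"

definition has_covariance :: "'s measure \<Rightarrow> ('s \<Rightarrow> real^'n) \<Rightarrow> real^'n^'n \<Rightarrow> bool" where
  "has_covariance M z C \<longleftrightarrow>
     has_bochner_integral M
       (\<lambda>\<omega>. outer_product (z \<omega> - integral\<^sup>L M z) (z \<omega> - integral\<^sup>L M z)) C"

definition linear_estimator :: "real^'n^'m \<Rightarrow> real^'m \<Rightarrow> real^'n \<Rightarrow> real^'m" where
  "linear_estimator A b v = A *v v + b"

definition unbiased :: "'s measure \<Rightarrow> ('s \<Rightarrow> real^'m) \<Rightarrow> ('s \<Rightarrow> real^'m) \<Rightarrow> bool" where
  "unbiased M yhat y \<longleftrightarrow>
     integrable M yhat \<and> integrable M y \<and> integral\<^sup>L M yhat = integral\<^sup>L M y"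

definition sum_of_variances :: "'s measure \<Rightarrow> ('s \<Rightarrow> real^'m) \<Rightarrow> real" where
  "sum_of_variances M z = (\<integral>\<omega>. (z \<omega> - integral\<^sup>L M z) \<bullet> (z \<omega> - integral\<^sup>L M z) \<partial>M)"

text \<open>
  The mean square error is taken relative to the quantity \<open>y\<close> being estimated.
  If \<open>y\<close> is deterministic, the mean square error of an unbiased estimator is the sum of the
  variances of its components (\<open>mse_deterministic\<close>); in general it is the sum of the variances
  of the components of the estimation error (\<open>mse_eq_sum_of_variances_error\<close>).

  For a random \<open>y\<close> the sum of variances of the estimator itself would not do as an error:
  it vanishes for every constant estimator (\<open>sum_of_variances_constant_estimator\<close>), so its
  minimum over the unbiased linear estimators is attained with \<open>A = 0\<close>, and with
  \<open>A = \<Sigma>\<^sub>y\<^sub>x \<Sigma>\<^sub>x\<^sub>x\<^sup>-\<^sup>1\<close> only if \<open>\<Sigma>\<^sub>y\<^sub>x = 0\<close>.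
\<close>

definition mse :: "'s measure \<Rightarrow> ('s \<Rightarrow> real^'m) \<Rightarrow> ('s \<Rightarrow> real^'m) \<Rightarrow> real" where
  "mse M yhat y = (\<integral>\<omega>. (yhat \<omega> - y \<omega>) \<bullet> (yhat \<omega> - y \<omega>) \<partial>M)"

definition min_mse_unbiased_linear ::
  "'s measure \<Rightarrow> ('s \<Rightarrow> real^'n) \<Rightarrow> ('s \<Rightarrow> real^'m) \<Rightarrow> real^'n^'m \<Rightarrow> real^'m \<Rightarrow> bool" where
  "min_mse_unbiased_linear M x y A b \<longleftrightarrow>
     unbiased M (\<lambda>\<omega>. linear_estimator A b (x \<omega>)) y \<and>
     (\<forall>A' b'. unbiased M (\<lambda>\<omega>. linear_estimator A' b' (x \<omega>)) y \<longrightarrow>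
        mse M (\<lambda>\<omega>. linear_estimator A b (x \<omega>)) y
          \<le> mse M (\<lambda>\<omega>. linear_estimator A' b' (x \<omega>)) y)"

lemma mse_deterministic:
  assumes "prob_space M" and "unbiased M yhat (\<lambda>_. c)"
  shows "mse M yhat (\<lambda>_. c) = sum_of_variances M yhat"
proof -
  interpret prob_space M by fact
  show ?thesis
    using assms(2) by (simp add: unbiased_def mse_def sum_of_variances_def prob_space)
qed

lemma mse_eq_sum_of_variances_error:
  assumes "unbiased M yhat y"
  shows "mse M yhat y = sum_of_variances M (\<lambda>\<omega>. yhat \<omega> - y \<omega>)"
  using assms by (simp add: unbiased_def mse_def sum_of_variances_def)

lemma sum_of_variances_constant_estimator:
  assumes "prob_space M"
  shows "sum_of_variances M (\<lambda>\<omega>. linear_estimator 0 b (x \<omega>)) = 0"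
proof -
  interpret prob_space M by fact
  show ?thesis by (simp add: sum_of_variances_def linear_estimator_def prob_space)
qed

lemma outer_product_nth [simp]: "outer_product u v $ i $ j = u $ i * v $ j"
  by (simp add: outer_product_def matrix_matrix_mult_def columnvector_def rowvector_def)

lemma stack_nth [simp]: "stack u v $ Inl i = u $ i" "stack u v $ Inr j = v $ j"
  by (simp_all add: stack_def)

lemma block_matrix_nth [simp]:
  "block_matrix P Q R S $ Inl i = stack (P $ i) (Q $ i)"
  "block_matrix P Q R S $ Inr j = stack (R $ j) (S $ j)"
  by (simp_all add: block_matrix_def)

lemma has_bochner_integral_vec_iff:
  fixes f :: "'s \<Rightarrow> ('a::euclidean_space)^'n"
  shows "has_bochner_integral M f c \<longleftrightarrow> (\<forall>i. has_bochner_integral M (\<lambda>\<omega>. f \<omega> $ i) (c $ i))"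
proof
  assume "has_bochner_integral M f c"
  then show "\<forall>i. has_bochner_integral M (\<lambda>\<omega>. f \<omega> $ i) (c $ i)"
    using has_bochner_integral_bounded_linear[OF bounded_linear_vec_nth] by blast
next
  assume *: "\<forall>i. has_bochner_integral M (\<lambda>\<omega>. f \<omega> $ i) (c $ i)"
  have lin: "bounded_linear (\<lambda>a. axis i a :: 'a^'n)" for i
    by (intro linear_linear[THEN iffD2] linearI) (auto simp: axis_def vec_eq_iff)
  have ax: "(\<Sum>i\<in>UNIV. axis i (v $ i)) = v" for v :: "'a^'n"
    by (simp add: vec_eq_iff axis_def if_distrib[of "\<lambda>g. _ g"] cong: if_cong)
  have "has_bochner_integral M (\<lambda>\<omega>. \<Sum>i\<in>UNIV. axis i (f \<omega> $ i)) (\<Sum>i\<in>UNIV. axis i (c $ i))"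
    by (intro has_bochner_integral_sum has_bochner_integral_bounded_linear[OF lin]) (use * in auto)
  then show "has_bochner_integral M f c"
    by (simp add: ax)
qed

lemma all_sum_iff: "(\<forall>k. P k) \<longleftrightarrow> (\<forall>i. P (Inl i)) \<and> (\<forall>j. P (Inr j))"
  by (metis sum.exhaust)

lemma has_mean_stack_iff:
  "has_mean M (\<lambda>\<omega>. stack (x \<omega>) (y \<omega>)) (stack \<mu>\<^sub>x \<mu>\<^sub>y) \<longleftrightarrow> has_mean M x \<mu>\<^sub>x \<and> has_mean M y \<mu>\<^sub>y"
  unfolding has_mean_def
  by (simp add: has_bochner_integral_vec_iff[of _ x] has_bochner_integral_vec_iff[of _ y]
      has_bochner_integral_vec_iff[of _ "\<lambda>\<omega>. stack (x \<omega>) (y \<omega>)"] all_sum_iff)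

text \<open>The blocks of the joint covariance matrix are the covariance matrices of \<open>x\<close> and \<open>y\<close>.\<close>

lemma has_covariance_stackD:
  fixes x :: "'s \<Rightarrow> real^'n" and y :: "'s \<Rightarrow> real^'m"
  assumes m: "has_mean M (\<lambda>\<omega>. stack (x \<omega>) (y \<omega>)) (stack \<mu>\<^sub>x \<mu>\<^sub>y)"
    and c: "has_covariance M (\<lambda>\<omega>. stack (x \<omega>) (y \<omega>)) (block_matrix \<Sigma>\<^sub>x\<^sub>x \<Sigma>\<^sub>x\<^sub>y \<Sigma>\<^sub>y\<^sub>x \<Sigma>\<^sub>y\<^sub>y)"
  shows "\<Sigma>\<^sub>x\<^sub>x = cross_covariance M x x" "\<Sigma>\<^sub>y\<^sub>y = cross_covariance M y y"
    "\<Sigma>\<^sub>y\<^sub>x = cross_covariance M y x" "\<Sigma>\<^sub>x\<^sub>y = transpose \<Sigma>\<^sub>y\<^sub>x"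
proof -
  from m have mean: "integral\<^sup>L M (\<lambda>\<omega>. stack (x \<omega>) (y \<omega>)) = stack \<mu>\<^sub>x \<mu>\<^sub>y"
    by (simp add: has_mean_def has_bochner_integral_iff)
  from m have mx: "integral\<^sup>L M x = \<mu>\<^sub>x" and my: "integral\<^sup>L M y = \<mu>\<^sub>y"
    unfolding has_mean_stack_iff by (simp_all add: has_mean_def has_bochner_integral_iff)
  note c' = c[unfolded has_covariance_def mean has_bochner_integral_vec_iff[where 'a="real^('n+'m)"]
      has_bochner_integral_vec_iff[where 'a=real], simplified all_sum_iff, simplified]
  have xx: "has_bochner_integral M (\<lambda>\<omega>. outer_product (x \<omega> - \<mu>\<^sub>x) (x \<omega> - \<mu>\<^sub>x)) \<Sigma>\<^sub>x\<^sub>x"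
    and yy: "has_bochner_integral M (\<lambda>\<omega>. outer_product (y \<omega> - \<mu>\<^sub>y) (y \<omega> - \<mu>\<^sub>y)) \<Sigma>\<^sub>y\<^sub>y"
    and yx: "has_bochner_integral M (\<lambda>\<omega>. outer_product (y \<omega> - \<mu>\<^sub>y) (x \<omega> - \<mu>\<^sub>x)) \<Sigma>\<^sub>y\<^sub>x"
    using c' by (simp_all add: has_bochner_integral_vec_iff)
  then show "\<Sigma>\<^sub>x\<^sub>x = cross_covariance M x x" "\<Sigma>\<^sub>y\<^sub>y = cross_covariance M y y"
    "\<Sigma>\<^sub>y\<^sub>x = cross_covariance M y x"
    by (simp_all add: cross_covariance_def mx my has_bochner_integral_iff)
  have "\<Sigma>\<^sub>x\<^sub>y $ i $ j = \<Sigma>\<^sub>y\<^sub>x $ j $ i" for i j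
    using c' by (auto simp: has_bochner_integral_iff mult.commute)
  then show "\<Sigma>\<^sub>x\<^sub>y = transpose \<Sigma>\<^sub>y\<^sub>x"
    by (simp add: vec_eq_iff transpose_def)
qed

end

theory Submission
  imports Defs
begin

text \<open>
  An unbiased linear estimator has error \<open>A' u - v\<close> with \<open>u = x - \<mu>\<^sub>x\<close> and \<open>v = y - \<mu>\<^sub>y\<close>.
  For \<open>A = \<Sigma>\<^sub>y\<^sub>x \<Sigma>\<^sub>x\<^sub>x\<^sup>-\<^sup>1\<close> the error \<open>e = A u - v\<close> is uncorrelated with \<open>u\<close>, as
  \<open>E[e u\<^sup>T] = A \<Sigma>\<^sub>x\<^sub>x - \<Sigma>\<^sub>y\<^sub>x = 0\<close>. Hence by Pythagoras the error \<open>(A' - A) u + e\<close> of any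
  competitor has mean square \<open>E|(A' - A) u|\<^sup>2 + E|e|\<^sup>2 \<ge> E|e|\<^sup>2\<close>.
\<close>

lemma has_mean_imp_integral_eq:
  "has_mean M z \<mu> \<Longrightarrow> integral\<^sup>L M z = \<mu>"
  by (simp add: has_mean_def has_bochner_integral_iff)

text \<open>\<open>has_covariance_stackD\<close> gives only the values of the blocks. This version
  keeps the existence of the integrals too, without which the mean square could not be split into
  summands.\<close>

lemma has_covariance_stack_blocks:
  fixes x :: "'s \<Rightarrow> real^'n" and y :: "'s \<Rightarrow> real^'m"
  assumes m: "has_mean M (\<lambda>\<omega>. stack (x \<omega>) (y \<omega>)) (stack \<mu>\<^sub>x \<mu>\<^sub>y)"
    and c: "has_covariance M (\<lambda>\<omega>. stack (x \<omega>) (y \<omega>)) (block_matrix \<Sigma>\<^sub>x\<^sub>x \<Sigma>\<^sub>x\<^sub>y \<Sigma>\<^sub>y\<^sub>x \<Sigma>\<^sub>y\<^sub>y)"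
  shows "has_bochner_integral M (\<lambda>\<omega>. outer_product (x \<omega> - \<mu>\<^sub>x) (x \<omega> - \<mu>\<^sub>x)) \<Sigma>\<^sub>x\<^sub>x"
    "has_bochner_integral M (\<lambda>\<omega>. outer_product (y \<omega> - \<mu>\<^sub>y) (x \<omega> - \<mu>\<^sub>x)) \<Sigma>\<^sub>y\<^sub>x"
    "has_bochner_integral M (\<lambda>\<omega>. outer_product (y \<omega> - \<mu>\<^sub>y) (y \<omega> - \<mu>\<^sub>y)) \<Sigma>\<^sub>y\<^sub>y"
proof -
  note c' = c[unfolded has_covariance_def has_mean_imp_integral_eq[OF m]
      has_bochner_integral_vec_iff[where 'a="real^('n+'m)"]
      has_bochner_integral_vec_iff[where 'a=real], simplified all_sum_iff, simplified]
  then show "has_bochner_integral M (\<lambda>\<omega>. outer_product (x \<omega> - \<mu>\<^sub>x) (x \<omega> - \<mu>\<^sub>x)) \<Sigma>\<^sub>x\<^sub>x"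
    "has_bochner_integral M (\<lambda>\<omega>. outer_product (y \<omega> - \<mu>\<^sub>y) (x \<omega> - \<mu>\<^sub>x)) \<Sigma>\<^sub>y\<^sub>x"
    "has_bochner_integral M (\<lambda>\<omega>. outer_product (y \<omega> - \<mu>\<^sub>y) (y \<omega> - \<mu>\<^sub>y)) \<Sigma>\<^sub>y\<^sub>y"
    by (simp_all add: has_bochner_integral_vec_iff)
qed

text \<open>On matrices, \<open>\<bullet>\<close> is the entrywise (Frobenius) inner product. Scalar
  products of vectors thus become linear functionals of an outer product, and their integrability
  and expectation follow from those of the matrix.\<close>

lemma inner_outer_product: "B \<bullet> outer_product u v = (B *v v) \<bullet> u"
  by (simp add: inner_vec_def matrix_vector_mult_def sum_distrib_left sum_distrib_right mult_ac)

lemma inner_mat_1_outer_product: "mat 1 \<bullet> outer_product u v = v \<bullet> u"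
  by (simp add: inner_outer_product)

lemma outer_product_diff_left: "outer_product (u - v) w = outer_product u w - outer_product v w"
  by (simp add: vec_eq_iff left_diff_distrib)

lemma outer_product_mult_left: "outer_product (B *v u) v = B ** outer_product u v"
  by (simp add: vec_eq_iff matrix_vector_mult_def matrix_matrix_mult_def sum_distrib_left sum_distrib_right mult_ac)

lemma has_bochner_integral_matrix_mult_left:
  fixes B :: "real^'n^'m" and F :: "'s \<Rightarrow> real^'k^'n"
  assumes "has_bochner_integral M F C"
  shows "has_bochner_integral M (\<lambda>\<omega>. B ** F \<omega>) (B ** C)"
proof (rule has_bochner_integral_bounded_linear[OF _ assms])
  show "bounded_linear (\<lambda>X :: real^'k^'n. B ** X)"
    by (intro linear_linear[THEN iffD2] linearI)
      (simp_all add: vec_eq_iff matrix_matrix_mult_def sum.distrib sum_distrib_left algebra_simps)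
qed

text \<open>The value \<open>A ** C\<close> in \<open>vu\<close> expresses the normal equation for
  least squares, which makes the error of \<open>A\<close> orthogonal to every linear function of
  \<open>u\<close>.\<close>

lemma mean_square_linear_error_le:
  fixes u :: "'s \<Rightarrow> real^'n" and v :: "'s \<Rightarrow> real^'m" and A A' :: "real^'n^'m"
  assumes uu: "has_bochner_integral M (\<lambda>\<omega>. outer_product (u \<omega>) (u \<omega>)) C"
    and vu: "has_bochner_integral M (\<lambda>\<omega>. outer_product (v \<omega>) (u \<omega>)) (A ** C)"
    and vv: "integrable M (\<lambda>\<omega>. outer_product (v \<omega>) (v \<omega>))"
  shows "(\<integral>\<omega>. (A *v u \<omega> - v \<omega>) \<bullet> (A *v u \<omega> - v \<omega>) \<partial>M)
    \<le> (\<integral>\<omega>. (A' *v u \<omega> - v \<omega>) \<bullet> (A' *v u \<omega> - v \<omega>) \<partial>M)"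
proof -
  define e where "e \<omega> = A *v u \<omega> - v \<omega>" for \<omega>
  define d where "d \<omega> = (A' - A) *v u \<omega>" for \<omega>
  have eu: "has_bochner_integral M (\<lambda>\<omega>. outer_product (e \<omega>) (u \<omega>)) 0"
    using has_bochner_integral_diff[OF has_bochner_integral_matrix_mult_left[where B = A, OF uu] vu]
    by (simp add: e_def outer_product_diff_left outer_product_mult_left)
  then have de: "has_bochner_integral M (\<lambda>\<omega>. d \<omega> \<bullet> e \<omega>) 0"
    using has_bochner_integral_inner_right[of "A' - A", OF eu]
    by (simp add: d_def inner_outer_product)
  \<comment> \<open>With \<open>B = A' - A\<close>, the integrand is
    \<open>B \<bullet> outer_product (B *v u) u\<close>, which equals
    \<open>(B *v u) \<bullet> (B *v u)\<close>.\<close>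
  have "integrable M (\<lambda>\<omega>. (A' - A) \<bullet> ((A' - A) ** outer_product (u \<omega>) (u \<omega>)))"
    using has_bochner_integral_matrix_mult_left[OF uu]
    by (intro integrable_inner_right) (auto intro: integrable.intros)
  then have dd: "integrable M (\<lambda>\<omega>. d \<omega> \<bullet> d \<omega>)"
    by (simp add: d_def inner_outer_product flip: outer_product_mult_left)
  \<comment> \<open>Expanding one factor \<open>e = A *v u - v\<close> at a time gives
    \<open>e \<bullet> e\<close> as
    \<open>(A *v u) \<bullet> e - (A *v u) \<bullet> v + v \<bullet> v\<close>. Each term is a
    linear functional of an integrable outer product; for the last one it is the trace.\<close>
  have "integrable M (\<lambda>\<omega>. A \<bullet> outer_product (e \<omega>) (u \<omega>) - A \<bullet> outer_product (v \<omega>) (u \<omega>)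
      + mat 1 \<bullet> outer_product (v \<omega>) (v \<omega>))"
    using eu vu vv
    by (intro Bochner_Integration.integrable_add Bochner_Integration.integrable_diff
        integrable_inner_right) (auto intro: integrable.intros)
  also have "(\<lambda>\<omega>. A \<bullet> outer_product (e \<omega>) (u \<omega>) - A \<bullet> outer_product (v \<omega>) (u \<omega>)
      + mat 1 \<bullet> outer_product (v \<omega>) (v \<omega>)) = (\<lambda>\<omega>. e \<omega> \<bullet> e \<omega>)"
    by (simp add: fun_eq_iff inner_outer_product inner_mat_1_outer_product e_def
        inner_diff_left inner_diff_right inner_commute)
  finally have ee: "integrable M (\<lambda>\<omega>. e \<omega> \<bullet> e \<omega>)" .
  have split: "(A' *v u \<omega> - v \<omega>) \<bullet> (A' *v u \<omega> - v \<omega>) = d \<omega> \<bullet> d \<omega> + 2 * (d \<omega> \<bullet> e \<omega>) + e \<omega> \<bullet> e \<omega>"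
    for \<omega>
  proof -
    have "A' *v u \<omega> - v \<omega> = d \<omega> + e \<omega>"
      by (simp add: d_def e_def matrix_vector_mult_diff_rdistrib)
    then show ?thesis
      by (simp add: inner_add_left inner_add_right inner_commute)
  qed
  \<comment> \<open>The added integral is nonnegative; the cross term inserted next integrates to 0
    by \<open>de\<close>.\<close>
  have "(\<integral>\<omega>. e \<omega> \<bullet> e \<omega> \<partial>M) \<le> (\<integral>\<omega>. d \<omega> \<bullet> d \<omega> \<partial>M) + (\<integral>\<omega>. e \<omega> \<bullet> e \<omega> \<partial>M)"
    by simp
  also have "\<dots> = (\<integral>\<omega>. d \<omega> \<bullet> d \<omega> + 2 * (d \<omega> \<bullet> e \<omega>) + e \<omega> \<bullet> e \<omega> \<partial>M)"
    using dd de ee by (simp add: has_bochner_integral_iff)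
  finally show ?thesis
    by (simp add: split flip: e_def)
qed

lemma integral_linear_estimator:
  assumes "prob_space M" and "integrable M x"
  shows "integrable M (\<lambda>\<omega>. linear_estimator B c (x \<omega>))"
    "(\<integral>\<omega>. linear_estimator B c (x \<omega>) \<partial>M) = linear_estimator B c (integral\<^sup>L M x)"
proof -
  interpret prob_space M by fact
  have lin: "bounded_linear ((*v) B)"
    by (simp add: linear_linear)
  note int = integrable_bounded_linear[OF lin assms(2)]
  from int show "integrable M (\<lambda>\<omega>. linear_estimator B c (x \<omega>))"
    by (simp add: linear_estimator_def)
  from int show "(\<integral>\<omega>. linear_estimator B c (x \<omega>) \<partial>M) = linear_estimator B c (integral\<^sup>L M x)"
    by (simp add: linear_estimator_def integral_bounded_linear[OF lin assms(2)] prob_space)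
qed

text \<open>Expectation commutes with the affine map, so unbiasedness determines the shift from the
  matrix. The minimisation therefore runs over the matrix alone.\<close>

lemma unbiased_linear_estimator_iff:
  assumes "prob_space M" and "has_mean M x \<mu>\<^sub>x" and "has_mean M y \<mu>\<^sub>y"
  shows "unbiased M (\<lambda>\<omega>. linear_estimator B c (x \<omega>)) y \<longleftrightarrow> c = \<mu>\<^sub>y - B *v \<mu>\<^sub>x"
  using assms
  by (auto simp: unbiased_def has_mean_def has_bochner_integral_iff integral_linear_estimator
      linear_estimator_def[of _ _ \<mu>\<^sub>x] algebra_simps)

theorem theorem5p1:
  fixes M :: "'s measure"
    and x :: "'s \<Rightarrow> real^'n" and y :: "'s \<Rightarrow> real^'m"
    and \<mu>\<^sub>x :: "real^'n" and \<mu>\<^sub>y :: "real^'m"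
    and \<Sigma>\<^sub>x\<^sub>x :: "real^'n^'n" and \<Sigma>\<^sub>x\<^sub>y :: "real^'m^'n"
    and \<Sigma>\<^sub>y\<^sub>x :: "real^'n^'m" and \<Sigma>\<^sub>y\<^sub>y :: "real^'m^'m"
    and A :: "real^'n^'m" and b :: "real^'m"
  assumes "prob_space M"
    and "x \<in> borel_measurable M" and "y \<in> borel_measurable M"
    and "has_mean M (\<lambda>\<omega>. stack (x \<omega>) (y \<omega>)) (stack \<mu>\<^sub>x \<mu>\<^sub>y)"
    and "has_covariance M (\<lambda>\<omega>. stack (x \<omega>) (y \<omega>)) (block_matrix \<Sigma>\<^sub>x\<^sub>x \<Sigma>\<^sub>x\<^sub>y \<Sigma>\<^sub>y\<^sub>x \<Sigma>\<^sub>y\<^sub>y)"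
    and "invertible \<Sigma>\<^sub>x\<^sub>x"
    and "b = \<mu>\<^sub>y - A *v \<mu>\<^sub>x"
    and "A = \<Sigma>\<^sub>y\<^sub>x ** matrix_inv \<Sigma>\<^sub>x\<^sub>x"
  shows "min_mse_unbiased_linear M x y A b"
proof -
  have mx: "has_mean M x \<mu>\<^sub>x" and my: "has_mean M y \<mu>\<^sub>y"
    using assms(4) by (simp_all add: has_mean_stack_iff)
  note blocks = has_covariance_stack_blocks[OF assms(4,5)]
  \<comment> \<open>\<open>matrix_inv\<close> is a Hilbert choice of a two-sided inverse, so its
    defining property rests on the existence given by invertibility.\<close>
  have "matrix_inv \<Sigma>\<^sub>x\<^sub>x ** \<Sigma>\<^sub>x\<^sub>x = mat 1"
    using someI_ex[OF assms(6)[unfolded invertible_def]] by (simp add: matrix_inv_def)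
  then have "A ** \<Sigma>\<^sub>x\<^sub>x = \<Sigma>\<^sub>y\<^sub>x"
    by (simp add: assms(8) flip: matrix_mul_assoc)
  with blocks(2) have yx: "has_bochner_integral M
      (\<lambda>\<omega>. outer_product (y \<omega> - \<mu>\<^sub>y) (x \<omega> - \<mu>\<^sub>x)) (A ** \<Sigma>\<^sub>x\<^sub>x)"
    by simp
  \<comment> \<open>With the shift forced by unbiasedness, the error of any matrix \<open>B\<close>
    depends only on the centred vectors.\<close>
  have error: "linear_estimator B (\<mu>\<^sub>y - B *v \<mu>\<^sub>x) (x \<omega>) - y \<omega> = B *v (x \<omega> - \<mu>\<^sub>x) - (y \<omega> - \<mu>\<^sub>y)"
    for B \<omega>
    by (simp add: linear_estimator_def matrix_vector_mult_diff_distrib)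
  show ?thesis
    unfolding min_mse_unbiased_linear_def unbiased_linear_estimator_iff[OF assms(1) mx my]
    using mean_square_linear_error_le[OF blocks(1) yx integrable.intros[OF blocks(3)]]
    by (simp add: assms(7) mse_def error)
qed

end
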